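(* Let $\phi=\tilde p/p$ be a rational inner function on $\mathbb{D}^2$ with $\deg\phi=(m,n)$ and a singularity on $\mathbb{T}^2$ with $z_2$-coordinate $\tau_2$. Then there exist a rational number $K>0$, constants $0<c\le C$, and a neighborhood $U\subseteq\mathbb{T}$ of $\tau_2$ such that $c|\tau_2-\zeta_2|^K\le \epsilon(\phi,\zeta_2)\le C|\tau_2-\zeta_2|^K$ for all $\zeta_2\in U$.
   Context: $\phi=\tilde p/p$ where $p\in\mathbb{C}[z_1,z_2]$ has bidegree $(m,n)$, no zeros in $\mathbb{D}^2$, is atoral (finitely many zeros on $\mathbb{T}^2$, no common factor with $\tilde p$), and $\tilde p(z)=z_1^mz_2^n\overline{p(1/\bar z_1,1/\bar z_2)}$. A singularity of $\phi$ is a zero of $p$ on $\mathbb{T}^2$. For $\zeta_2\in\mathbb{T}$ not the $z_2$-coordinate of a singularity, $\epsilon(\phi,\zeta_2)=\min\{1-|z_1|:\tilde p(z_1,\zeta_2)=0\}$; otherwise $\epsilon(\phi,\zeta_2)=0$. *)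

theory Defs
  imports "HOL-Analysis.Analysis" "HOL-Computational_Algebra.Polynomial"
begin

text \<open>A polynomial in C[z1,z2] is represented as a polynomial in z2 whose
coefficients are polynomials in z1: the coefficient of z1^i z2^j of p is
coeff (coeff p j) i.\<close>

definition peval2 :: "complex poly poly \<Rightarrow> complex \<Rightarrow> complex \<Rightarrow> complex" where
  "peval2 p z1 z2 = poly (map_poly (\<lambda>c. poly c z1) p) z2"

definition deg1 :: "complex poly poly \<Rightarrow> nat" where
  "deg1 p = Max ((\<lambda>j. degree (coeff p j)) ` {..degree p})"

definition deg2 :: "complex poly poly \<Rightarrow> nat" where
  "deg2 p = degree p"

definition has_bidegree :: "complex poly poly \<Rightarrow> nat \<Rightarrow> nat \<Rightarrow> bool" where
  "has_bidegree p m n \<longleftrightarrow> p \<noteq> 0 \<and> deg1 p = m \<and> deg2 p = n"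

text \<open>Reflection p~(z) = z1^m z2^n conj(p(1/conj z1, 1/conj z2)), written out
on coefficients.\<close>
definition reflect2 :: "nat \<Rightarrow> nat \<Rightarrow> complex poly poly \<Rightarrow> complex poly poly" where
  "reflect2 m n p = (\<Sum>i\<le>m. \<Sum>j\<le>n.
      monom (monom (cnj (coeff (coeff p j) i)) (m - i)) (n - j))"

definition no_zeros_bidisk :: "complex poly poly \<Rightarrow> bool" where
  "no_zeros_bidisk p \<longleftrightarrow> (\<forall>z1 z2. cmod z1 < 1 \<longrightarrow> cmod z2 < 1 \<longrightarrow> peval2 p z1 z2 \<noteq> 0)"

definition atoral :: "nat \<Rightarrow> nat \<Rightarrow> complex poly poly \<Rightarrow> bool" where
  "atoral m n p \<longleftrightarrow>
     finite {(z1, z2). cmod z1 = 1 \<and> cmod z2 = 1 \<and> peval2 p z1 z2 = 0}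
     \<and> coprime p (reflect2 m n p)"

text \<open>singularities of phi = p~/p: zeros of p on T^2\<close>
definition is_singularity :: "complex poly poly \<Rightarrow> complex \<Rightarrow> complex \<Rightarrow> bool" where
  "is_singularity p z1 z2 \<longleftrightarrow> cmod z1 = 1 \<and> cmod z2 = 1 \<and> peval2 p z1 z2 = 0"

definition eps_phi :: "nat \<Rightarrow> nat \<Rightarrow> complex poly poly \<Rightarrow> complex \<Rightarrow> real" where
  "eps_phi m n p \<zeta>2 =
     (if \<exists>z1. is_singularity p z1 \<zeta>2 then 0
      else Inf {1 - cmod z1 | z1. peval2 (reflect2 m n p) z1 \<zeta>2 = 0})"

end

theory Submission
  imports Defs "HOL-Computational_Algebra.Polynomial_FPS"
    "HOL-Computational_Algebra.Fundamental_Theorem_Algebra"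
begin

text \<open>
  For \<open>\<zeta>\<close> on the unit circle let \<open>z\<^sub>1, \<dots>, z\<^sub>m\<close> be the zeros of the reflected polynomial at height \<open>\<zeta>\<close>;
  by a Hurwitz-type limit argument they lie in the closed disc. Because
  \<open>|1 - a cnj b|\<^sup>2 = (1 - |a|\<^sup>2) (1 - |b|\<^sup>2) + |a - b|\<^sup>2\<close>, the smallest of the \<open>m\<^sup>2\<close> numbers
  \<open>r\<^sub>i\<^sub>j = 1 - z\<^sub>i cnj z\<^sub>j\<close> in modulus is \<open>min (1 - |z\<^sub>i|\<^sup>2)\<close>, which is comparable to \<open>\<epsilon>\<close>.
  Unlike the numbers \<open>1 - |z\<^sub>i|\<^sup>2\<close> themselves, the \<open>r\<^sub>i\<^sub>j\<close> have power sums that are polynomials in the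
  power sums of the \<open>z\<^sub>i\<close> and their conjugates; by Newton's identities the coefficients of
  \<open>\<Prod> (1 - r\<^sub>i\<^sub>j X)\<close> are therefore rational functions of \<open>\<zeta>\<close> on the circle. Each of them is comparable
  to an integral power of \<open>|\<zeta> - \<tau>\<^sub>2|\<close>, and the size of the smallest \<open>r\<^sub>i\<^sub>j\<close> is read off from these
  orders. This replaces Puiseux expansions of the individual branches.
\<close>

section \<open>Products of factors 1 - r_i X: Newton's identities and coefficient bounds\<close>

text \<open>Logarithmic differentiation: \<open>L i\<close> is the geometric series r_i X / (1 - r_i
  X), and the product rule, applied one factor at a time, gives X E' = - E * (sum of the
  \<open>L i\<close>). Comparing coefficients of X^k yields the identity.\<close>

lemma newton_identity:
  fixes r :: "'i \<Rightarrow> 'a::field_char_0"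
  assumes "finite I"
  defines "E \<equiv> \<Prod>i\<in>I. [:1, - r i:]"
  shows "of_nat k * coeff E k = - (\<Sum>j<k. coeff E j * (\<Sum>i\<in>I. r i ^ (k - j)))"
proof -
  define L where "L = (\<lambda>i. Abs_fps (\<lambda>k. if k = 0 then 0 else r i ^ k))"
  have L: "(1 - fps_const (r i) * fps_X) * L i = fps_const (r i) * fps_X" for i
  proof (rule fps_ext)
    fix n
    show "fps_nth ((1 - fps_const (r i) * fps_X) * L i) n = fps_nth (fps_const (r i) * fps_X) n"
      by (cases n) (auto simp: L_def left_diff_distrib mult.assoc fps_X_mult_nth fps_X_nth simp flip: power_Suc)
  qed
  have step: "fps_of_poly [:1, - r i:] = 1 - fps_const (r i) * fps_X" for i
    by (simp add: fps_of_poly_pCons)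
  have "fps_X * fps_deriv (fps_of_poly (\<Prod>i\<in>I. [:1, - r i:]))
      = - (fps_of_poly (\<Prod>i\<in>I. [:1, - r i:]) * (\<Sum>i\<in>I. L i))"
    using assms(1)
  proof (induction I)
    case empty
    then show ?case by simp
  next
    case (insert a I)
    let ?P = "fps_of_poly (\<Prod>i\<in>I. [:1, - r i:])"
    let ?M = "1 - fps_const (r a) * fps_X"
    have "fps_X * fps_deriv (?M * ?P) = ?M * (fps_X * fps_deriv ?P) - fps_const (r a) * fps_X * ?P"
      by (simp add: algebra_simps)
    also have "\<dots> = - (?M * ?P * (\<Sum>i\<in>I. L i)) - ?M * L a * ?P"
      unfolding insert.IH L by (simp add: algebra_simps)
    also have "\<dots> = - ((?M * ?P) * (\<Sum>i\<in>insert a I. L i))"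
      using insert.hyps by (simp add: algebra_simps)
    finally show ?case
      unfolding prod.insert[OF insert.hyps] fps_of_poly_mult step .
  qed
  hence "fps_nth (fps_X * fps_deriv (fps_of_poly E)) k = fps_nth (- (fps_of_poly E * (\<Sum>i\<in>I. L i))) k"
    by (simp add: E_def)
  moreover have "fps_nth (fps_X * fps_deriv (fps_of_poly E)) k = of_nat k * coeff E k"
    by (cases k) simp_all
  moreover have "fps_nth (fps_of_poly E * (\<Sum>i\<in>I. L i)) k
      = (\<Sum>j\<le>k. coeff E j * (\<Sum>i\<in>I. if k - j = 0 then 0 else r i ^ (k - j)))"
    by (simp add: fps_mult_nth L_def fps_sum_nth atLeast0AtMost)
  moreover have "\<dots> = (\<Sum>j<k. coeff E j * (\<Sum>i\<in>I. r i ^ (k - j)))"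
    by (rule sum.mono_neutral_cong_right) (auto intro!: sum.cong)
  ultimately show ?thesis by simp
qed

lemma degree_prod_one_minus_le:
  "degree (\<Prod>i\<in>I. [:1, - r i :: complex:]) \<le> card I"
proof (induction I rule: infinite_finite_induct)
  case (insert a I)
  have "degree ([:1, - r a:] * (\<Prod>i\<in>I. [:1, - r i:])) \<le> 1 + card I"
    by (rule order.trans[OF degree_mult_le]) (use insert.IH in \<open>intro add_mono, auto\<close>)
  with insert.hyps show ?case by (simp del: mult_pCons_left)
qed simp_all

lemma coeff_prod_one_minus_card:
  assumes "finite I"
  shows "coeff (\<Prod>i\<in>I. [:1, - r i :: complex:]) (card I) = (\<Prod>i\<in>I. - r i)"
  using assms
proof (induction I)
  case (insert a I)
  have "coeff (\<Prod>i\<in>I. [:1, - r i:]) (Suc (card I)) = 0"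
    by (rule coeff_eq_0) (use degree_prod_one_minus_le[of r I] in simp)
  with insert show ?case by (simp add: coeff_pCons)
qed simp

text \<open>Up to sign, coefficient \<open>j\<close> is a sum of at most 2^N products of
  \<open>j\<close> of the \<open>r i\<close>, where N = \<open>card I\<close>. Replacing the N - j
  copies of \<open>\<rho>\<close> by the moduli of the missing factors completes each product to the
  full one. Taken at the smallest modulus, the lemma bounds that modulus from above.\<close>

lemma coeff_prod_one_minus_le:
  fixes r :: "'i \<Rightarrow> complex"
  assumes "finite I" "0 \<le> \<rho>" "\<And>i. i \<in> I \<Longrightarrow> \<rho> \<le> cmod (r i)" "j \<le> card I"
  shows "cmod (coeff (\<Prod>i\<in>I. [:1, - r i:]) j) * \<rho> ^ (card I - j)
           \<le> 2 ^ card I * cmod (coeff (\<Prod>i\<in>I. [:1, - r i:]) (card I))"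
proof -
  have "cmod (coeff (\<Prod>i\<in>I. [:1, - r i:]) j) * \<rho> ^ (card I - j) \<le> 2 ^ card I * (\<Prod>i\<in>I. cmod (r i))"
    using assms(1,3,4)
  proof (induction I arbitrary: j)
    case empty
    then show ?case by simp
  next
    case (insert a I)
    let ?E = "\<Prod>i\<in>I. [:1, - r i:]" and ?N = "card I"
    let ?B = "2 ^ ?N * (\<Prod>i\<in>I. cmod (r i))"
    have B: "?B \<ge> 0" by (simp add: prod_nonneg)
    have ra: "\<rho> \<le> cmod (r a)" using insert.prems by simp
    have 1: "cmod (coeff ?E j) * \<rho> ^ (Suc ?N - j) \<le> cmod (r a) * ?B"
    proof (cases "j \<le> ?N")
      case True
      have "cmod (coeff ?E j) * \<rho> ^ (Suc ?N - j) = \<rho> * (cmod (coeff ?E j) * \<rho> ^ (?N - j))"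
        using True by (simp add: Suc_diff_le)
      also have "\<dots> \<le> cmod (r a) * ?B"
        by (rule mult_mono[OF ra insert.IH]) (use insert.prems True assms(2) in auto)
      finally show ?thesis .
    next
      case False
      hence "coeff ?E j = 0"
        by (intro coeff_eq_0) (use degree_prod_one_minus_le[of r I] in simp)
      thus ?thesis using B by (simp add: prod_nonneg)
    qed
    have 2: "cmod (coeff (pCons 0 ?E) j) * cmod (r a) * \<rho> ^ (Suc ?N - j) \<le> cmod (r a) * ?B"
    proof (cases j)
      case 0
      then show ?thesis using B by (simp add: prod_nonneg)
    next
      case (Suc i)
      have "cmod (coeff ?E i) * \<rho> ^ (?N - i) \<le> ?B"
        using insert.IH[of i] insert.prems insert.hyps Suc by auto
      from mult_left_mono[OF this, of "cmod (r a)"] Suc show ?thesis by (simp add: mult_ac)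
    qed
    have "(\<Prod>i\<in>insert a I. [:1, - r i:]) = ?E - smult (r a) (pCons 0 ?E)"
      using insert.hyps by simp
    hence "cmod (coeff (\<Prod>i\<in>insert a I. [:1, - r i:]) j)
        \<le> cmod (coeff ?E j) + cmod (r a) * cmod (coeff (pCons 0 ?E) j)"
      by (metis coeff_diff coeff_smult norm_mult norm_triangle_ineq4)
    hence "cmod (coeff (\<Prod>i\<in>insert a I. [:1, - r i:]) j) * \<rho> ^ (Suc ?N - j)
        \<le> (cmod (coeff ?E j) + cmod (r a) * cmod (coeff (pCons 0 ?E) j)) * \<rho> ^ (Suc ?N - j)"
      by (rule mult_right_mono) (use assms(2) in simp)
    also have "\<dots> \<le> cmod (r a) * ?B + cmod (r a) * ?B"
      using 1 2 by (simp add: algebra_simps)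
    also have "\<dots> = 2 ^ Suc ?N * (\<Prod>i\<in>insert a I. cmod (r i))"
      using insert.hyps by simp
    finally show ?case using insert.hyps by (simp del: prod.insert)
  qed
  thus ?thesis
    by (simp add: coeff_prod_one_minus_card assms(1) flip: prod_norm)
qed

lemma poly_altdef_le:
  fixes f :: "'a::comm_semiring_1 poly"
  assumes "degree f \<le> n"
  shows "poly f x = (\<Sum>i\<le>n. coeff f i * x ^ i)"
  unfolding poly_altdef
  by (rule sum.mono_neutral_left) (use assms in \<open>auto simp: coeff_eq_0\<close>)

text \<open>The product vanishes at 1 / r_i; multiplying by r_i^N, with N = \<open>card I\<close>,
  isolates the top coefficient. For r_i = 0 the top coefficient is itself 0. Taken at the smallest
  root, the lemma bounds its modulus from below.\<close>

lemma coeff_prod_one_minus_ge: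
  fixes r :: "'i \<Rightarrow> complex"
  assumes "finite I" "i \<in> I"
  shows "cmod (coeff (\<Prod>i\<in>I. [:1, - r i:]) (card I))
          \<le> (\<Sum>j<card I. cmod (coeff (\<Prod>i\<in>I. [:1, - r i:]) j) * cmod (r i) ^ (card I - j))"
proof (cases "r i = 0")
  case True
  have "(\<Prod>i\<in>I. - r i) = 0"
    using True assms by (intro prod_zero) auto
  thus ?thesis
    unfolding coeff_prod_one_minus_card[OF assms(1)] by (simp add: sum_nonneg)
next
  case False
  let ?E = "\<Prod>i\<in>I. [:1, - r i:]" and ?N = "card I"
  have "poly ?E (1 / r i) = 0"
    using assms False by (auto simp: poly_prod intro!: prod_zero)
  hence "0 = r i ^ ?N * (\<Sum>j\<le>?N. coeff ?E j * (1 / r i) ^ j)"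
    using poly_altdef_le[OF degree_prod_one_minus_le[of r I]] by simp
  also have "\<dots> = (\<Sum>j\<le>?N. coeff ?E j * r i ^ (?N - j))"
    unfolding sum_distrib_left
    by (rule sum.cong) (use False in \<open>auto simp: power_diff power_divide\<close>)
  also have "\<dots> = coeff ?E ?N + (\<Sum>j<?N. coeff ?E j * r i ^ (?N - j))"
    by (simp add: lessThan_Suc_atMost[symmetric])
  finally have "coeff ?E ?N = - (\<Sum>j<?N. coeff ?E j * r i ^ (?N - j))"
    unfolding eq_neg_iff_add_eq_0 by (rule sym)
  hence "cmod (coeff ?E ?N) = cmod (\<Sum>j<?N. coeff ?E j * r i ^ (?N - j))"
    by simp
  also have "\<dots> \<le> (\<Sum>j<?N. cmod (coeff ?E j) * cmod (r i) ^ (?N - j))"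
    by (rule order.trans[OF norm_sum]) (simp add: norm_mult norm_power)
  finally show ?thesis .
qed

section \<open>Polynomials without zeros in the open disc\<close>

lemma complex_poly_factorization:
  fixes f :: "complex poly"
  assumes "f \<noteq> 0"
  shows "\<exists>z. f = smult (lead_coeff f) (\<Prod>i<degree f. [:- z i, 1:])"
proof -
  obtain A where A: "size A = degree f" "f = smult (lead_coeff f) (\<Prod>x\<in>#A. [:-x, 1:])"
    using alg_closed_imp_factorization[OF assms] by blast
  obtain xs where xs: "mset xs = A" using ex_mset by blast
  have "(\<Prod>x\<in>#A. [:-x, 1:]) = prod_list (map (\<lambda>x. [:-x, 1:]) xs)"
    by (simp add: prod_mset_prod_list flip: xs mset_map)
  also have "\<dots> = (\<Prod>i<length xs. [:- (xs ! i), 1:])"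
    by (simp add: prod.list_conv_set_nth atLeast0LessThan)
  finally show ?thesis
    using A xs by (metis size_mset)
qed

lemma reflect_poly_linear: "reflect_poly [:- z, 1:] = [:1, - z :: complex:]"
  by (rule poly_eqI) (auto simp: coeff_reflect_poly coeff_pCons split: nat.splits)

text \<open>Factoring the reversed polynomial gives f(x) = f(0) * prod (1 - w_i x). A factor with
  |w_i| > 1 would put the zero 1 / w_i inside the disc, so every factor has modulus between 1 - |x|
  and 2. The constants depend on \<open>m\<close> and \<open>x\<close> only, so the bounds survive a
  limit of polynomials; this is the Hurwitz-type ingredient.\<close>

lemma zero_free_disc_poly_bounds:
  fixes f :: "complex poly"
  assumes nz: "\<And>x. cmod x < 1 \<Longrightarrow> poly f x \<noteq> 0" and deg: "degree f \<le> m" and x: "cmod x \<le> 1"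
  shows "cmod (poly f x) \<le> 2 ^ m * cmod (poly f 0)"
    and "(1 - cmod x) ^ m * cmod (poly f 0) \<le> cmod (poly f x)"
proof -
  let ?d = "degree f"
  have f0: "poly f 0 \<noteq> 0" using nz[of 0] by simp
  hence c0: "coeff f 0 \<noteq> 0" by (simp add: poly_0_coeff_0)
  define g where "g = reflect_poly f"
  have g: "g \<noteq> 0" "degree g = ?d" "lead_coeff g = coeff f 0"
    using c0 by (auto simp: g_def coeff_reflect_poly)
  obtain w where "g = smult (lead_coeff g) (\<Prod>i<degree g. [:- w i, 1:])"
    using complex_poly_factorization[OF g(1)] by blast
  hence "reflect_poly g = reflect_poly (smult (coeff f 0) (\<Prod>i<?d. [:- w i, 1:]))"
    using g(2,3) by simp
  hence "reflect_poly g = smult (coeff f 0) (\<Prod>i<?d. [:1, - w i:])"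
    by (simp add: reflect_poly_smult reflect_poly_prod reflect_poly_linear)
  hence f: "f = smult (coeff f 0) (\<Prod>i<?d. [:1, - w i:])"
    using c0 by (simp add: g_def)
  have ev: "poly f y = poly f 0 * (\<Prod>i<?d. 1 - w i * y)" for y
    by (subst f) (simp add: poly_prod poly_0_coeff_0 mult.commute)
  have w: "cmod (w i) \<le> 1" if "i < ?d" for i
  proof (rule ccontr)
    assume "\<not> cmod (w i) \<le> 1"
    hence "cmod (1 / w i) < 1" "w i \<noteq> 0" by (auto simp: norm_divide divide_less_eq)
    moreover have "(\<Prod>j<?d. 1 - w j * (1 / w i)) = 0"
      using that \<open>w i \<noteq> 0\<close> by (intro prod_zero) auto
    hence "poly f (1 / w i) = 0"
      using ev[of "1 / w i"] by simp
    ultimately show False using nz by blast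
  qed
  have up: "cmod (1 - w i * x) \<le> 2" and lo: "1 - cmod x \<le> cmod (1 - w i * x)" if "i < ?d" for i
  proof -
    have "cmod (w i * x) \<le> 1 * cmod x"
      unfolding norm_mult by (rule mult_right_mono) (use w that in auto)
    thus "cmod (1 - w i * x) \<le> 2" "1 - cmod x \<le> cmod (1 - w i * x)"
      using x norm_triangle_ineq4[of 1 "w i * x"] norm_triangle_ineq2[of 1 "w i * x"] by auto
  qed
  have P: "cmod (poly f x) = cmod (poly f 0) * (\<Prod>i<?d. cmod (1 - w i * x))"
    by (subst ev) (simp add: norm_mult prod_norm)
  have "(\<Prod>i<?d. cmod (1 - w i * x)) \<le> (\<Prod>i<?d. 2)"
    by (rule prod_mono) (use up in auto)
  also have "\<dots> \<le> 2 ^ m" using deg by simp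
  finally show "cmod (poly f x) \<le> 2 ^ m * cmod (poly f 0)"
    unfolding P by (subst mult.commute) (simp add: mult_right_mono)
  have "(1 - cmod x) ^ m \<le> (1 - cmod x) ^ ?d"
    by (rule power_decreasing) (use deg x in auto)
  also have "\<dots> = (\<Prod>i<?d. 1 - cmod x)" by simp
  also have "\<dots> \<le> (\<Prod>i<?d. cmod (1 - w i * x))"
    by (rule prod_mono) (use lo x in auto)
  finally show "(1 - cmod x) ^ m * cmod (poly f 0) \<le> cmod (poly f x)"
    unfolding P by (subst mult.commute) (simp add: mult_left_mono)
qed

section \<open>Rational functions on the unit circle\<close>

text \<open>Only values on the circle are constrained, which makes the class closed under complex
  conjugation. Excluding zeros of the denominator on the whole circle rules out poles at the point
  under study.\<close>

definition rational_on_circle :: "(complex \<Rightarrow> complex) \<Rightarrow> bool" where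
  "rational_on_circle f \<longleftrightarrow>
     (\<exists>A B. \<forall>\<zeta>. cmod \<zeta> = 1 \<longrightarrow> poly B \<zeta> \<noteq> 0 \<and> f \<zeta> = poly A \<zeta> / poly B \<zeta>)"

lemma rational_on_circleI:
  assumes "\<And>\<zeta>. cmod \<zeta> = 1 \<Longrightarrow> poly B \<zeta> \<noteq> 0"
    and "\<And>\<zeta>. cmod \<zeta> = 1 \<Longrightarrow> f \<zeta> = poly A \<zeta> / poly B \<zeta>"
  shows "rational_on_circle f"
  using assms unfolding rational_on_circle_def by blast

lemma rational_on_circle_cong:
  assumes "rational_on_circle f" "\<And>\<zeta>. cmod \<zeta> = 1 \<Longrightarrow> g \<zeta> = f \<zeta>"
  shows "rational_on_circle g"
  using assms unfolding rational_on_circle_def by metis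

lemma rational_on_circle_poly: "rational_on_circle (\<lambda>\<zeta>. poly A \<zeta>)"
  by (rule rational_on_circleI[of 1 _ A]) auto

lemma rational_on_circle_const: "rational_on_circle (\<lambda>_. c)"
  using rational_on_circle_poly[of "[:c:]"] by simp

lemma rational_on_circle_add:
  assumes "rational_on_circle f" "rational_on_circle g"
  shows "rational_on_circle (\<lambda>\<zeta>. f \<zeta> + g \<zeta>)"
proof -
  obtain A B where f: "\<And>\<zeta>. cmod \<zeta> = 1 \<Longrightarrow> poly B \<zeta> \<noteq> 0" "\<And>\<zeta>. cmod \<zeta> = 1 \<Longrightarrow> f \<zeta> = poly A \<zeta> / poly B \<zeta>"
    using assms(1) unfolding rational_on_circle_def by blast
  obtain C D where g: "\<And>\<zeta>. cmod \<zeta> = 1 \<Longrightarrow> poly D \<zeta> \<noteq> 0" "\<And>\<zeta>. cmod \<zeta> = 1 \<Longrightarrow> g \<zeta> = poly C \<zeta> / poly D \<zeta>"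
    using assms(2) unfolding rational_on_circle_def by blast
  show ?thesis
    by (rule rational_on_circleI[of "B * D" _ "A * D + C * B"]) (auto simp: f g add_frac_eq)
qed

lemma rational_on_circle_mult:
  assumes "rational_on_circle f" "rational_on_circle g"
  shows "rational_on_circle (\<lambda>\<zeta>. f \<zeta> * g \<zeta>)"
proof -
  obtain A B where f: "\<And>\<zeta>. cmod \<zeta> = 1 \<Longrightarrow> poly B \<zeta> \<noteq> 0" "\<And>\<zeta>. cmod \<zeta> = 1 \<Longrightarrow> f \<zeta> = poly A \<zeta> / poly B \<zeta>"
    using assms(1) unfolding rational_on_circle_def by blast
  obtain C D where g: "\<And>\<zeta>. cmod \<zeta> = 1 \<Longrightarrow> poly D \<zeta> \<noteq> 0" "\<And>\<zeta>. cmod \<zeta> = 1 \<Longrightarrow> g \<zeta> = poly C \<zeta> / poly D \<zeta>"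
    using assms(2) unfolding rational_on_circle_def by blast
  show ?thesis
    by (rule rational_on_circleI[of "B * D" _ "A * C"]) (auto simp: f g)
qed

lemma rational_on_circle_inverse:
  assumes "rational_on_circle f" "\<And>\<zeta>. cmod \<zeta> = 1 \<Longrightarrow> f \<zeta> \<noteq> 0"
  shows "rational_on_circle (\<lambda>\<zeta>. inverse (f \<zeta>))"
proof -
  obtain A B where f: "\<And>\<zeta>. cmod \<zeta> = 1 \<Longrightarrow> poly B \<zeta> \<noteq> 0" "\<And>\<zeta>. cmod \<zeta> = 1 \<Longrightarrow> f \<zeta> = poly A \<zeta> / poly B \<zeta>"
    using assms(1) unfolding rational_on_circle_def by blast
  show ?thesis
    by (rule rational_on_circleI[of A _ B]) (use assms(2) f in auto)
qed

lemma rational_on_circle_minus: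
  "rational_on_circle f \<Longrightarrow> rational_on_circle (\<lambda>\<zeta>. - f \<zeta>)"
  using rational_on_circle_mult[OF rational_on_circle_const[of "-1"]] by simp

lemma rational_on_circle_sum:
  "(\<And>i. i \<in> I \<Longrightarrow> rational_on_circle (f i)) \<Longrightarrow> rational_on_circle (\<lambda>\<zeta>. \<Sum>i\<in>I. f i \<zeta>)"
  by (induction I rule: infinite_finite_induct)
    (auto simp: rational_on_circle_const rational_on_circle_add)

text \<open>On the circle cnj \<zeta> = 1 / \<zeta>, so conjugating a polynomial value amounts to
  reversing the conjugated coefficients and dividing by a power of \<zeta>. The two monomials in the
  witness clear these powers.\<close>

lemma rational_on_circle_cnj:
  assumes "rational_on_circle f"
  shows "rational_on_circle (\<lambda>\<zeta>. cnj (f \<zeta>))"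
proof -
  obtain A B where f: "\<And>\<zeta>. cmod \<zeta> = 1 \<Longrightarrow> poly B \<zeta> \<noteq> 0" "\<And>\<zeta>. cmod \<zeta> = 1 \<Longrightarrow> f \<zeta> = poly A \<zeta> / poly B \<zeta>"
    using assms unfolding rational_on_circle_def by blast
  define R :: "complex poly \<Rightarrow> complex poly" where "R = (\<lambda>A. reflect_poly (map_poly cnj A))"
  have R: "poly (R A) \<zeta> = \<zeta> ^ degree A * cnj (poly A \<zeta>)" if "cmod \<zeta> = 1" for A \<zeta>
  proof -
    have nz: "\<zeta> \<noteq> 0" using that by auto
    have "cnj \<zeta> = inverse \<zeta>"
      using that by (simp add: inverse_complex_def cmod_def complex_eq_iff)
    hence "cnj (poly A \<zeta>) = poly (map_poly cnj A) (inverse \<zeta>)"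
      using poly_cnj[of A \<zeta>] by simp
    moreover have "degree (map_poly cnj A) = degree A"
      by (rule degree_map_poly) simp
    ultimately show ?thesis
      unfolding R_def poly_reflect_poly_nz[OF nz] by simp
  qed
  show ?thesis
  proof (rule rational_on_circleI[of "R B * monom 1 (degree A)" _ "R A * monom 1 (degree B)"])
    fix \<zeta> :: complex assume \<zeta>: "cmod \<zeta> = 1"
    hence nz: "\<zeta> \<noteq> 0" by auto
    show "poly (R B * monom 1 (degree A)) \<zeta> \<noteq> 0"
      using nz f(1)[OF \<zeta>] by (simp add: R[OF \<zeta>] poly_monom)
    show "cnj (f \<zeta>) = poly (R A * monom 1 (degree B)) \<zeta> / poly (R B * monom 1 (degree A)) \<zeta>"
      using nz f(1)[OF \<zeta>] by (simp add: R[OF \<zeta>] f(2)[OF \<zeta>] poly_monom)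
  qed
qed

section \<open>Vanishing orders and the power law for the smallest root\<close>

text \<open>The exponent is the order of \<tau> as a zero of the numerator. The remaining factor
  \<open>g\<close> is continuous and nonzero at \<tau>, hence nearby its modulus lies between half
  and twice |g(\<tau>)|; \<open>M\<close> covers both estimates.\<close>

lemma rational_on_circle_asymp:
  assumes "rational_on_circle f" "cmod \<tau> = 1" and nz: "\<exists>\<zeta>. cmod \<zeta> = 1 \<and> f \<zeta> \<noteq> 0"
  shows "\<exists>a M. M > 0 \<and> (f \<tau> = 0 \<longleftrightarrow> a > 0) \<and>
    (\<forall>\<^sub>F \<zeta> in at \<tau> within sphere 0 1.
       cmod (\<tau> - \<zeta>) ^ a \<le> M * cmod (f \<zeta>) \<and> cmod (f \<zeta>) \<le> M * cmod (\<tau> - \<zeta>) ^ a)"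
proof -
  obtain A B where f: "\<And>\<zeta>. cmod \<zeta> = 1 \<Longrightarrow> poly B \<zeta> \<noteq> 0" "\<And>\<zeta>. cmod \<zeta> = 1 \<Longrightarrow> f \<zeta> = poly A \<zeta> / poly B \<zeta>"
    using assms(1) unfolding rational_on_circle_def by blast
  have "A \<noteq> 0" using nz f by fastforce
  then obtain A' where A': "A = [:- \<tau>, 1:] ^ order \<tau> A * A'" "\<not> [:- \<tau>, 1:] dvd A'"
    using order_decomp by blast
  define a where "a = order \<tau> A"
  define g where "g = (\<lambda>\<zeta>. poly A' \<zeta> / poly B \<zeta>)"
  have fg: "f \<zeta> = (\<zeta> - \<tau>) ^ a * g \<zeta>" if "cmod \<zeta> = 1" for \<zeta>
    using f(2)[OF that] by (subst (asm) A'(1)) (simp add: g_def a_def)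
  have g0: "g \<tau> \<noteq> 0"
    using A'(2) f(1)[OF assms(2)] by (simp add: g_def poly_eq_0_iff_dvd)
  define M where "M = max (2 / cmod (g \<tau>)) (2 * cmod (g \<tau>))"
  have M: "2 / cmod (g \<tau>) \<le> M" "2 * cmod (g \<tau>) \<le> M" "M > 0"
    using g0 by (auto simp: M_def less_max_iff_disj)
  have "((\<lambda>\<zeta>. cmod (g \<zeta>)) \<longlongrightarrow> cmod (g \<tau>)) (at \<tau> within sphere 0 1)"
    unfolding g_def by (intro tendsto_intros f assms)
  hence "\<forall>\<^sub>F \<zeta> in at \<tau> within sphere 0 1. cmod (g \<zeta>) > cmod (g \<tau>) / 2"
        "\<forall>\<^sub>F \<zeta> in at \<tau> within sphere 0 1. cmod (g \<zeta>) < 2 * cmod (g \<tau>)"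
    by (rule order_tendstoD; use g0 in simp)+
  moreover have "\<forall>\<^sub>F \<zeta> in at \<tau> within sphere 0 1. \<zeta> \<in> sphere 0 1"
    by (simp add: eventually_at_filter)
  ultimately have "\<forall>\<^sub>F \<zeta> in at \<tau> within sphere 0 1.
       cmod (\<tau> - \<zeta>) ^ a \<le> M * cmod (f \<zeta>) \<and> cmod (f \<zeta>) \<le> M * cmod (\<tau> - \<zeta>) ^ a"
  proof eventually_elim
    case (elim \<zeta>)
    have eq: "cmod (f \<zeta>) = cmod (\<tau> - \<zeta>) ^ a * cmod (g \<zeta>)"
      using elim(3) by (simp add: fg norm_mult norm_power norm_minus_commute)
    have "1 = (2 / cmod (g \<tau>)) * (cmod (g \<tau>) / 2)" using g0 by simp
    also have "\<dots> \<le> M * cmod (g \<zeta>)"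
      by (intro mult_mono) (use M elim in auto)
    finally have "cmod (\<tau> - \<zeta>) ^ a * 1 \<le> cmod (\<tau> - \<zeta>) ^ a * (M * cmod (g \<zeta>))"
      by (rule mult_left_mono) simp
    moreover have "cmod (\<tau> - \<zeta>) ^ a * cmod (g \<zeta>) \<le> cmod (\<tau> - \<zeta>) ^ a * M"
      by (rule mult_left_mono) (use M elim in auto)
    ultimately show ?case
      unfolding eq by (simp add: mult_ac)
  qed
  moreover have "f \<tau> = 0 \<longleftrightarrow> a > 0"
    using fg[OF assms(2)] g0 by (cases a) auto
  ultimately show ?thesis using M(3) by blast
qed

text \<open>Newton polygon: the exponent of the smallest root is the largest slope, and it can be read off
  from the vanishing orders of the coefficients, which do not see from which side \<open>\<tau>\<close> is approached.\<close>

lemma smallest_root_power_law: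
  fixes f :: "nat \<Rightarrow> complex \<Rightarrow> complex" and \<rho> :: "complex \<Rightarrow> real"
  assumes rat: "\<And>j. rational_on_circle (f j)" and \<tau>: "cmod \<tau> = 1" and "N > 0"
    and f0: "\<And>\<zeta>. f 0 \<zeta> = 1" and fN: "f N \<tau> = 0" "\<exists>\<zeta>. cmod \<zeta> = 1 \<and> f N \<zeta> \<noteq> 0"
    and \<rho>: "\<And>\<zeta>. cmod \<zeta> = 1 \<Longrightarrow> \<rho> \<zeta> \<ge> 0"
    and up: "\<And>\<zeta> j. cmod \<zeta> = 1 \<Longrightarrow> j < N \<Longrightarrow> cmod (f j \<zeta>) * \<rho> \<zeta> ^ (N - j) \<le> D * cmod (f N \<zeta>)"
    and lo: "\<And>\<zeta>. cmod \<zeta> = 1 \<Longrightarrow> cmod (f N \<zeta>) \<le> (\<Sum>j<N. cmod (f j \<zeta>) * \<rho> \<zeta> ^ (N - j))"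
  shows "\<exists>K c C. K \<in> \<rat> \<and> K > 0 \<and> 0 < c \<and> 0 < C \<and>
    (\<forall>\<^sub>F \<zeta> in at \<tau> within sphere 0 1.
       c * cmod (\<tau> - \<zeta>) powr K \<le> \<rho> \<zeta> \<and> \<rho> \<zeta> \<le> C * cmod (\<tau> - \<zeta>) powr K)"
proof -
  \<comment> \<open>A coefficient vanishing on the whole circle has no finite order and contributes
    nothing to the sum in \<open>lo\<close>. Index 0 always remains because \<open>f 0\<close> is
    constantly 1.\<close>
  define J where "J = {j. j < N \<and> (\<exists>\<zeta>. cmod \<zeta> = 1 \<and> f j \<zeta> \<noteq> 0)}"
  have J: "finite J" "0 \<in> J" "\<And>j. j \<in> J \<Longrightarrow> j < N"
    using \<open>N > 0\<close> f0 by (auto simp: J_def intro!: exI[of _ 1])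
  have Jz: "f j \<zeta> = 0" if "cmod \<zeta> = 1" "j < N" "j \<notin> J" for j \<zeta>
    using that by (auto simp: J_def)
  let ?F = "at \<tau> within sphere 0 1"
  have "\<forall>j\<in>insert N J. \<exists>a M. M > 0 \<and> (f j \<tau> = 0 \<longleftrightarrow> a > 0) \<and> (\<forall>\<^sub>F \<zeta> in ?F.
       cmod (\<tau> - \<zeta>) ^ a \<le> M * cmod (f j \<zeta>) \<and> cmod (f j \<zeta>) \<le> M * cmod (\<tau> - \<zeta>) ^ a)"
    using rational_on_circle_asymp[OF rat \<tau>] fN(2) by (auto simp: J_def)
  from bchoice[OF this] obtain a where "\<forall>j\<in>insert N J. \<exists>M. M > 0 \<and> (f j \<tau> = 0 \<longleftrightarrow> a j > 0) \<and> (\<forall>\<^sub>F \<zeta> in ?F.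
       cmod (\<tau> - \<zeta>) ^ a j \<le> M * cmod (f j \<zeta>) \<and> cmod (f j \<zeta>) \<le> M * cmod (\<tau> - \<zeta>) ^ a j)" ..
  from bchoice[OF this] obtain M where "\<forall>j\<in>insert N J. M j > 0 \<and> (f j \<tau> = 0 \<longleftrightarrow> a j > 0) \<and> (\<forall>\<^sub>F \<zeta> in ?F.
       cmod (\<tau> - \<zeta>) ^ a j \<le> M j * cmod (f j \<zeta>) \<and> cmod (f j \<zeta>) \<le> M j * cmod (\<tau> - \<zeta>) ^ a j)" ..
  hence aM: "\<And>j. j \<in> insert N J \<Longrightarrow> M j > 0" "\<And>j. j \<in> insert N J \<Longrightarrow> f j \<tau> = 0 \<longleftrightarrow> a j > 0"
      "\<And>j. j \<in> insert N J \<Longrightarrow> \<forall>\<^sub>F \<zeta> in ?F. cmod (\<tau> - \<zeta>) ^ a j \<le> M j * cmod (f j \<zeta>) \<and>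
          cmod (f j \<zeta>) \<le> M j * cmod (\<tau> - \<zeta>) ^ a j"
    by blast+
  \<comment> \<open>With s = |\<tau> - \<zeta>|, the bound \<open>up\<close> and the orders
    \<open>a\<close> give \<rho>^(N-j) <= const * s^(a N - a j), that is, \<rho> is at most a
    multiple of s^(slope j). As s < 1 near \<tau>, the largest slope gives the strongest
    bound.\<close>
  define slope where "slope = (\<lambda>j. (real (a N) - real (a j)) / real (N - j))"
  define K where "K = Max (slope ` J)"
  have "K \<in> slope ` J" unfolding K_def using J by (intro Max_in) auto
  then obtain i where i: "i \<in> J" "K = slope i" by auto
  have K_ge: "slope j \<le> K" if "j \<in> J" for j
    unfolding K_def using that J by (intro Max_ge) auto
  have "K \<in> \<rat>" unfolding i slope_def by (intro Rats_divide Rats_diff) auto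
  \<comment> \<open>Positivity of \<open>K\<close> comes from index 0: its slope is a N / N, and
    \<open>f N\<close> vanishes at \<tau>.\<close>
  have "a 0 = 0" using aM(2)[of 0] J(2) by (simp add: f0)
  hence "slope 0 > 0" using aM(2)[of N] fN(1) \<open>N > 0\<close> by (simp add: slope_def)
  hence "K > 0" using K_ge[OF J(2)] by simp
  define k where "k = N - i"
  have k: "k > 0" using J(3) i by (simp add: k_def)
  \<comment> \<open>The lower bound 1 ensures C <= C^k, so that the constant can be moved inside the
    k-th power before taking roots.\<close>
  define C where "C = max 1 (M i * D * M N)"
  define S where "S = (\<Sum>j\<in>J. M j)"
  have S: "S > 0" unfolding S_def using J aM by (intro sum_pos) auto
  have MN: "M N > 0" using aM by auto
  \<comment> \<open>The second entry makes c * M N * S at most 1/2, which is what the contradiction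
    for the lower bound uses; c <= 1 gives c^(N-j) <= c.\<close>
  define c where "c = min 1 (1 / (2 * M N * S))"
  have c: "0 < c" "c \<le> 1" "c * (M N * S) < 1"
  proof -
    have "c * (M N * S) \<le> 1 / (2 * M N * S) * (M N * S)"
      by (rule mult_right_mono) (use S MN in \<open>auto simp: c_def\<close>)
    also have "\<dots> < 1" using S MN by simp
    finally show "c * (M N * S) < 1" .
  qed (use S MN in \<open>auto simp: c_def\<close>)
  have "\<forall>\<^sub>F \<zeta> in ?F. \<forall>j\<in>insert N J. cmod (\<tau> - \<zeta>) ^ a j \<le> M j * cmod (f j \<zeta>) \<and>
          cmod (f j \<zeta>) \<le> M j * cmod (\<tau> - \<zeta>) ^ a j"
    using aM(3) J(1) by (intro eventually_ball_finite) auto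
  moreover have "\<forall>\<^sub>F \<zeta> in ?F. \<zeta> \<in> sphere 0 1 \<and> \<zeta> \<noteq> \<tau>"
    by (simp add: eventually_at_filter)
  moreover have "\<forall>\<^sub>F \<zeta> in ?F. cmod (\<tau> - \<zeta>) < 1"
  proof -
    have "((\<lambda>\<zeta>. cmod (\<tau> - \<zeta>)) \<longlongrightarrow> cmod (\<tau> - \<tau>)) ?F" by (intro tendsto_intros)
    thus ?thesis by (intro order_tendstoD) auto
  qed
  ultimately have "\<forall>\<^sub>F \<zeta> in ?F. c * cmod (\<tau> - \<zeta>) powr K \<le> \<rho> \<zeta> \<and> \<rho> \<zeta> \<le> C * cmod (\<tau> - \<zeta>) powr K"
  proof eventually_elim
    case (elim \<zeta>)
    define s where "s = cmod (\<tau> - \<zeta>)"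
    have s: "0 < s" "s < 1" and \<zeta>: "cmod \<zeta> = 1" using elim by (auto simp: s_def)
    have b: "s ^ a j \<le> M j * cmod (f j \<zeta>)" "cmod (f j \<zeta>) \<le> M j * s ^ a j" if "j = N \<or> j \<in> J" for j
      using elim(1) that by (auto simp: s_def)
    have "\<rho> \<zeta> \<le> C * s powr K"
    proof (rule iffD1[OF power_mono_iff[of "\<rho> \<zeta>" _ k]])
      have "s ^ a i * \<rho> \<zeta> ^ k \<le> (M i * cmod (f i \<zeta>)) * \<rho> \<zeta> ^ k"
        by (intro mult_right_mono b) (use i \<rho> \<zeta> in auto)
      also have "\<dots> \<le> M i * (D * cmod (f N \<zeta>))"
        using mult_left_mono[OF up[OF \<zeta> J(3)[OF i(1)]], of "M i"] aM(1)[of i] i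
        by (simp add: k_def mult_ac)
      also have "\<dots> \<le> M i * (D * (M N * s ^ a N))"
      proof (intro mult_left_mono b)
        \<comment> \<open>The sign is forced by \<open>up\<close> at index 0: its left side is
          nonnegative, while f N \<zeta> is nonzero at the nearby point \<zeta>.\<close>
        show "D \<ge> 0"
        proof (rule ccontr)
          assume "\<not> D \<ge> 0"
          moreover have "0 < s ^ a N" using s by simp
          hence "f N \<zeta> \<noteq> 0" using b(1)[of N] by auto
          ultimately have "D * cmod (f N \<zeta>) < 0" by (simp add: mult_less_0_iff)
          moreover have "cmod (f 0 \<zeta>) * \<rho> \<zeta> ^ (N - 0) \<ge> 0" using \<rho> \<zeta> by auto
          ultimately show False using up[OF \<zeta> \<open>N > 0\<close>] by linarith
        qed
      qed (use aM(1)[of i] i in auto)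
      finally have "s ^ a i * \<rho> \<zeta> ^ k \<le> (M i * D * M N) * s ^ a N" by (simp add: mult_ac)
      hence "\<rho> \<zeta> ^ k \<le> (M i * D * M N) * (s ^ a N / s ^ a i)"
        using s by (simp add: field_simps)
      also have "s ^ a N / s ^ a i = (s powr K) ^ k"
      proof -
        have "K * real k = real (a N) - real (a i)"
          using k unfolding i(2) slope_def k_def[symmetric] by simp
        hence "(s powr K) ^ k = s powr (real (a N) - real (a i))"
          using s by (simp add: powr_realpow[symmetric] powr_powr)
        thus ?thesis using s by (simp add: powr_diff powr_realpow)
      qed
      also have "(M i * D * M N) * (s powr K) ^ k \<le> C ^ k * (s powr K) ^ k"
      proof (rule mult_right_mono)
        have "M i * D * M N \<le> C" by (simp add: C_def)
        also have "C \<le> C ^ k" using k by (intro self_le_power) (auto simp: C_def)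
        finally show "M i * D * M N \<le> C ^ k" .
      qed simp
      finally show "\<rho> \<zeta> ^ k \<le> (C * s powr K) ^ k"
        by (simp add: power_mult_distrib)
    qed (use k \<rho> \<zeta> in \<open>auto simp: C_def\<close>)
    moreover have "c * s powr K \<le> \<rho> \<zeta>"
    proof (rule ccontr)
      assume neg: "\<not> c * s powr K \<le> \<rho> \<zeta>"
      \<comment> \<open>If \<rho> were below c * s^K, maximality of \<open>K\<close> would bound
        every term of \<open>lo\<close> by a multiple of c * s^(a N). Their sum would then be too
        small for the order \<open>a N\<close> of \<open>f N\<close>.\<close>
      have t: "cmod (f j \<zeta>) * \<rho> \<zeta> ^ (N - j) \<le> M j * (c * s ^ a N)" if "j \<in> J" for j
      proof -
        have Nj: "N - j > 0" using J(3)[OF that] by simp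
        have "\<rho> \<zeta> ^ (N - j) \<le> (c * s powr K) ^ (N - j)"
          by (rule power_mono) (use neg \<rho> \<zeta> in auto)
        also have "\<dots> = c ^ (N - j) * s powr (K * real (N - j))"
          using s by (simp add: power_mult_distrib powr_realpow[symmetric] powr_powr)
        also have "\<dots> \<le> c * s powr (real (a N) - real (a j))"
        proof (rule mult_mono)
          show "c ^ (N - j) \<le> c" using power_decreasing[of 1 "N - j" c] c Nj by simp
          have "slope j * real (N - j) \<le> K * real (N - j)"
            by (rule mult_right_mono[OF K_ge[OF that]]) simp
          hence "real (a N) - real (a j) \<le> K * real (N - j)"
            using Nj by (simp add: slope_def)
          thus "s powr (K * real (N - j)) \<le> s powr (real (a N) - real (a j))"
            using s by (intro powr_mono') auto
        qed (use c in auto)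
        finally have "cmod (f j \<zeta>) * \<rho> \<zeta> ^ (N - j) \<le> (M j * s ^ a j) * (c * s powr (real (a N) - real (a j)))"
          by (intro mult_mono b) (use that \<rho> \<zeta> aM(1)[of j] s in auto)
        also have "\<dots> = M j * (c * s ^ a N)"
          using s by (simp add: powr_diff powr_realpow)
        finally show ?thesis .
      qed
      have "s ^ a N \<le> M N * cmod (f N \<zeta>)" by (rule b) simp
      also have "\<dots> \<le> M N * (\<Sum>j<N. cmod (f j \<zeta>) * \<rho> \<zeta> ^ (N - j))"
        by (intro mult_left_mono lo \<zeta>) (use MN in auto)
      also have "(\<Sum>j<N. cmod (f j \<zeta>) * \<rho> \<zeta> ^ (N - j)) = (\<Sum>j\<in>J. cmod (f j \<zeta>) * \<rho> \<zeta> ^ (N - j))"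
        by (rule sum.mono_neutral_right) (use J Jz \<zeta> in auto)
      also have "M N * \<dots> \<le> M N * (\<Sum>j\<in>J. M j * (c * s ^ a N))"
        by (intro mult_left_mono sum_mono t) (use MN in auto)
      also have "\<dots> = (c * (M N * S)) * s ^ a N"
        by (simp add: S_def sum_distrib_left sum_distrib_right mult_ac)
      also have "\<dots> < 1 * s ^ a N"
        by (rule mult_strict_right_mono) (use c s in auto)
      finally show False by simp
    qed
    ultimately show ?case by (simp add: s_def)
  qed
  moreover have "C > 0" by (simp add: C_def less_max_iff_disj)
  ultimately show ?thesis using \<open>K \<in> \<rat>\<close> \<open>K > 0\<close> c by blast
qed

section \<open>Rationality of symmetric functions of the roots\<close>

text \<open>In Newton's identity the k-th power sum is multiplied by the coefficient at index 0,
  which is 1, so the identity can be solved recursively without division. The individual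
  \<open>r \<zeta> i\<close> may depend on \<zeta> in any way.\<close>

lemma power_sum_rational_on_circle:
  assumes "finite I" and rat: "\<And>k. rational_on_circle (\<lambda>\<zeta>. coeff (\<Prod>i\<in>I. [:1, - r \<zeta> i:]) k)"
  shows "rational_on_circle (\<lambda>\<zeta>. \<Sum>i\<in>I. r \<zeta> i ^ k)"
proof (induction k rule: less_induct)
  case (less k)
  show ?case
  proof (cases "k = 0")
    case True
    then show ?thesis by (simp add: rational_on_circle_const)
  next
    case False
    let ?e = "\<lambda>\<zeta>. coeff (\<Prod>i\<in>I. [:1, - r \<zeta> i:])"
    have e0: "?e \<zeta> 0 = 1" for \<zeta>
      by (simp add: poly_0_coeff_0[symmetric] poly_prod)
    have "(\<Sum>i\<in>I. r \<zeta> i ^ k) = - (of_nat k * ?e \<zeta> k + (\<Sum>j\<in>{0<..<k}. ?e \<zeta> j * (\<Sum>i\<in>I. r \<zeta> i ^ (k - j))))" for \<zeta>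
    proof -
      have "{..<k} = insert 0 {0<..<k}" using False by auto
      thus ?thesis
        using newton_identity[OF assms(1), of k "r \<zeta>"] by (simp add: e0)
    qed
    moreover have "rational_on_circle (\<lambda>\<zeta>. - (of_nat k * ?e \<zeta> k + (\<Sum>j\<in>{0<..<k}. ?e \<zeta> j * (\<Sum>i\<in>I. r \<zeta> i ^ (k - j)))))"
      by (intro rational_on_circle_minus rational_on_circle_add rational_on_circle_mult
          rational_on_circle_sum rational_on_circle_const rat less) auto
    ultimately show ?thesis by simp
  qed
qed

text \<open>The same recursion solved for the k-th coefficient instead, after division by k.\<close>

lemma coeff_prod_rational_on_circle:
  assumes "finite I" and rat: "\<And>k. rational_on_circle (\<lambda>\<zeta>. \<Sum>i\<in>I. r \<zeta> i ^ k)"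
  shows "rational_on_circle (\<lambda>\<zeta>. coeff (\<Prod>i\<in>I. [:1, - r \<zeta> i:]) k)"
proof (induction k rule: less_induct)
  case (less k)
  let ?e = "\<lambda>\<zeta>. coeff (\<Prod>i\<in>I. [:1, - r \<zeta> i:])"
  show ?case
  proof (cases "k = 0")
    case True
    have "?e \<zeta> 0 = 1" for \<zeta>
      by (simp add: poly_0_coeff_0[symmetric] poly_prod)
    with True show ?thesis by (simp add: rational_on_circle_const)
  next
    case False
    have "?e \<zeta> k = inverse (of_nat k) * - (\<Sum>j<k. ?e \<zeta> j * (\<Sum>i\<in>I. r \<zeta> i ^ (k - j)))" for \<zeta>
      unfolding newton_identity[OF assms(1), of k "r \<zeta>", symmetric] using False by simp
    moreover have "rational_on_circle (\<lambda>\<zeta>. inverse (of_nat k) * - (\<Sum>j<k. ?e \<zeta> j * (\<Sum>i\<in>I. r \<zeta> i ^ (k - j))))"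
      by (intro rational_on_circle_minus rational_on_circle_mult
          rational_on_circle_sum rational_on_circle_const rat less) auto
    ultimately show ?thesis by simp
  qed
qed

text \<open>Expand by the binomial theorem; the sum over all pairs of z_i^l cnj(z_j)^l then splits
  into a product. Summing over the diagonal alone would not factor, which is why all pairs are
  used.\<close>

lemma power_sum_one_minus_mult_cnj:
  fixes z :: "nat \<Rightarrow> complex"
  shows "(\<Sum>x\<in>{..<m} \<times> {..<m}. (case x of (i, j) \<Rightarrow> 1 - z i * cnj (z j)) ^ k)
      = (\<Sum>l\<le>k. (of_nat (k choose l) * (-1) ^ l) * ((\<Sum>i<m. z i ^ l) * cnj (\<Sum>i<m. z i ^ l)))"
proof -
  let ?I = "{..<m} \<times> {..<m}"
  have "(1 - a) ^ k = (\<Sum>l\<le>k. (of_nat (k choose l) * (-1) ^ l) * a ^ l)" for a :: complex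
    using binomial_ring[of "- a" 1 k] by (simp add: power_minus[of a] mult_ac)
  hence "(\<Sum>x\<in>?I. (case x of (i, j) \<Rightarrow> 1 - z i * cnj (z j)) ^ k)
      = (\<Sum>x\<in>?I. \<Sum>l\<le>k. (of_nat (k choose l) * (-1) ^ l) * (z (fst x) ^ l * cnj (z (snd x) ^ l)))"
    by (simp add: case_prod_unfold power_mult_distrib)
  also have "\<dots> = (\<Sum>l\<le>k. (of_nat (k choose l) * (-1) ^ l) * (\<Sum>x\<in>?I. z (fst x) ^ l * cnj (z (snd x) ^ l)))"
    by (subst sum.swap) (simp add: sum_distrib_left)
  also have "(\<lambda>l. \<Sum>x\<in>?I. z (fst x) ^ l * cnj (z (snd x) ^ l)) = (\<lambda>l. (\<Sum>i<m. z i ^ l) * cnj (\<Sum>i<m. z i ^ l))"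
    unfolding cnj_sum sum_product sum.cartesian_product by (simp add: case_prod_unfold)
  finally show ?thesis .
qed

lemma le_cmod_one_minus_mult_cnj:
  assumes "0 \<le> x" "x \<le> 1 - cmod a ^ 2" "x \<le> 1 - cmod b ^ 2"
  shows "x \<le> cmod (1 - a * cnj b)"
proof (rule power2_le_imp_le)
  have "x ^ 2 \<le> (1 - cmod a ^ 2) * (1 - cmod b ^ 2)"
    unfolding power2_eq_square[of x] by (rule mult_mono) (use assms in auto)
  also have "\<dots> \<le> (1 - cmod a ^ 2) * (1 - cmod b ^ 2) + cmod (a - b) ^ 2" by simp
  also have "\<dots> = cmod (1 - a * cnj b) ^ 2"
    unfolding cmod_power2 by (simp add: power2_eq_square algebra_simps)
  finally show "x ^ 2 \<le> cmod (1 - a * cnj b) ^ 2" .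
qed simp

section \<open>Slices of \<open>p\<close> and of its reflection at a fixed second coordinate\<close>

text \<open>Substituting a constant polynomial for the second variable keeps the slice a polynomial
  in the first, with coefficients, degree and factorization, where \<open>peval2\<close> gives only
  values.\<close>

lemma poly_poly_const: "poly (poly q [:\<zeta>:]) z = peval2 q z \<zeta>"
  unfolding peval2_def by (induction q) (auto simp: map_poly_pCons)

lemma coeff_poly_const:
  fixes q :: "complex poly poly"
  assumes "degree q \<le> n"
  shows "coeff (poly q [:\<zeta>:]) k = (\<Sum>j\<le>n. coeff (coeff q j) k * \<zeta> ^ j)"
  unfolding poly_altdef_le[OF assms]
  by (simp add: coeff_sum poly_const_pow mult.commute)

text \<open>Only the summand i = k reaches the exponent m - k. The right side exhibits the
  coefficient as a polynomial in \<zeta>, the source of all later rationality.\<close>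

lemma coeff_reflect2_const:
  assumes "k \<le> m"
  shows "coeff (poly (reflect2 m n p) [:\<zeta>:]) (m - k) = (\<Sum>j\<le>n. cnj (coeff (coeff p j) k) * \<zeta> ^ (n - j))"
proof -
  have "coeff (poly (reflect2 m n p) [:\<zeta>:]) (m - k)
      = (\<Sum>i\<le>m. \<Sum>j\<le>n. if i = k then cnj (coeff (coeff p j) k) * \<zeta> ^ (n - j) else 0)"
    unfolding reflect2_def poly_sum coeff_sum
    by (intro sum.cong refl) (use assms in \<open>auto simp: poly_monom poly_const_pow mult.commute\<close>)
  also have "\<dots> = (\<Sum>i\<le>m. if i = k then (\<Sum>j\<le>n. cnj (coeff (coeff p j) k) * \<zeta> ^ (n - j)) else 0)"
    by (intro sum.cong) auto
  also have "\<dots> = (\<Sum>j\<le>n. cnj (coeff (coeff p j) k) * \<zeta> ^ (n - j))"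
    using assms by simp
  finally show ?thesis .
qed

lemma degree_reflect2_const_le: "degree (poly (reflect2 m n p) [:\<zeta>:]) \<le> m"
  unfolding reflect2_def poly_sum
  by (intro degree_sum_le)
    (auto simp: poly_monom poly_const_pow intro!: order.trans[OF degree_smult_le] order.trans[OF degree_monom_le])

lemma degree_poly_const_le:
  assumes "has_bidegree p m n"
  shows "degree (poly p [:\<zeta>:]) \<le> m"
proof (rule degree_le, intro allI impI)
  fix k assume "m < k"
  have "degree (coeff p j) \<le> m" if "j \<le> n" for j
    using assms that by (auto simp: has_bidegree_def deg1_def deg2_def intro!: Max_ge)
  hence "coeff (coeff p j) k = 0" if "j \<le> n" for j
    using that \<open>m < k\<close> by (intro coeff_eq_0) (meson le_less_trans)
  moreover have "degree p \<le> n" using assms by (simp add: has_bidegree_def deg2_def)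
  ultimately show "coeff (poly p [:\<zeta>:]) k = 0"
    by (simp add: coeff_poly_const)
qed

lemma coeff_reflect2_circle:
  assumes "has_bidegree p m n" "cmod \<zeta> = 1" "k \<le> m"
  shows "coeff (poly (reflect2 m n p) [:\<zeta>:]) (m - k) = \<zeta> ^ n * cnj (coeff (poly p [:\<zeta>:]) k)"
proof -
  have nz: "\<zeta> \<noteq> 0" and c: "cnj \<zeta> = inverse \<zeta>"
    using assms(2) by (auto simp: inverse_complex_def cmod_def complex_eq_iff)
  have "degree p \<le> n" using assms(1) by (simp add: has_bidegree_def deg2_def)
  thus ?thesis
    unfolding coeff_reflect2_const[OF assms(3)] coeff_poly_const[OF \<open>degree p \<le> n\<close>] cnj_sum sum_distrib_left
    by (intro sum.cong) (auto simp: c nz power_diff power_inverse field_simps)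
qed

lemma poly_reflect2_circle:
  assumes "has_bidegree p m n" "cmod \<zeta> = 1" "z \<noteq> 0"
  shows "poly (poly (reflect2 m n p) [:\<zeta>:]) z = z ^ m * \<zeta> ^ n * cnj (poly (poly p [:\<zeta>:]) (1 / cnj z))"
proof -
  let ?Q = "poly (reflect2 m n p) [:\<zeta>:]" and ?P = "poly p [:\<zeta>:]"
  have "poly ?Q z = (\<Sum>i\<le>m. coeff ?Q i * z ^ i)"
    by (rule poly_altdef_le[OF degree_reflect2_const_le])
  also have "\<dots> = (\<Sum>k\<le>m. coeff ?Q (m - k) * z ^ (m - k))"
    by (rule sum.reindex_bij_witness[of _ "\<lambda>k. m - k" "\<lambda>k. m - k"]) auto
  also have "\<dots> = (\<Sum>k\<le>m. z ^ m * \<zeta> ^ n * cnj (coeff ?P k * (1 / cnj z) ^ k))"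
    by (intro sum.cong) (use assms in \<open>auto simp: coeff_reflect2_circle power_diff power_divide\<close>)
  also have "\<dots> = z ^ m * \<zeta> ^ n * cnj (poly ?P (1 / cnj z))"
    unfolding poly_altdef_le[OF degree_poly_const_le[OF assms(1)]] by (simp add: sum_distrib_left)
  finally show ?thesis .
qed

lemma infinite_unit_circle: "infinite (sphere (0::complex) 1)"
proof
  assume fin: "finite (sphere (0::complex) 1)"
  have "connected (sphere (0::complex) 1)" by (rule connected_sphere) simp
  hence "sphere (0::complex) 1 = {} \<or> (\<exists>a. sphere (0::complex) 1 = {a})"
    using fin connected_finite_iff_sing by blast
  moreover have "1 \<in> sphere (0::complex) 1" "-1 \<in> sphere (0::complex) 1" by auto
  ultimately show False by fastforce
qed

text \<open>For 0 < r < 1 the slice at height r\<zeta> has no zero in the disc, so the bounds of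
  \<open>zero_free_disc_poly_bounds\<close> apply and pass to the limit r -> 1. The limiting lower
  bound excludes zeros as soon as p(0, \<zeta>) is nonzero.\<close>

lemma zero_free_disc_circle:
  assumes bd: "has_bidegree p m n" and nz: "no_zeros_bidisk p" and at: "atoral m n p"
    and \<zeta>: "cmod \<zeta> = 1" and x: "cmod x < 1"
  shows "poly (poly p [:\<zeta>:]) x \<noteq> 0"
proof -
  have lim: "((\<lambda>r. cmod (peval2 p y (of_real r * \<zeta>))) \<longlongrightarrow> cmod (peval2 p y \<zeta>)) (at_left 1)" for y
  proof -
    have "((\<lambda>r. cmod (peval2 p y (of_real r * \<zeta>))) \<longlongrightarrow> cmod (peval2 p y (of_real 1 * \<zeta>))) (at_left (1::real))"
      unfolding peval2_def by (intro tendsto_intros)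
    thus ?thesis by simp
  qed
  have ev: "\<forall>\<^sub>F r in at_left (1::real). 0 < r \<and> r < 1"
    using eventually_at_left_real[of 0 "1::real"] by simp
  have free: "poly (poly p [:of_real r * \<zeta>:]) y \<noteq> 0" if "0 < r" "r < 1" "cmod y < 1" for r y
    using nz that \<zeta> by (auto simp: no_zeros_bidisk_def poly_poly_const norm_mult)
  have up: "cmod (peval2 p y \<zeta>) \<le> 2 ^ m * cmod (peval2 p 0 \<zeta>)" if "cmod y \<le> 1" for y
  proof (rule tendsto_le[OF _ tendsto_mult[OF tendsto_const lim] lim])
    show "\<forall>\<^sub>F r in at_left 1. cmod (peval2 p y (of_real r * \<zeta>)) \<le> 2 ^ m * cmod (peval2 p 0 (of_real r * \<zeta>))"
      using ev
    proof eventually_elim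
      case (elim r)
      show ?case
        using zero_free_disc_poly_bounds(1)[OF free degree_poly_const_le[OF bd] that] elim
        by (simp add: poly_poly_const)
    qed
  qed simp
  have lo: "(1 - cmod x) ^ m * cmod (peval2 p 0 \<zeta>) \<le> cmod (peval2 p x \<zeta>)"
  proof (rule tendsto_le[OF _ lim tendsto_mult[OF tendsto_const lim]])
    show "\<forall>\<^sub>F r in at_left 1. (1 - cmod x) ^ m * cmod (peval2 p 0 (of_real r * \<zeta>)) \<le> cmod (peval2 p x (of_real r * \<zeta>))"
      using ev
    proof eventually_elim
      case (elim r)
      show ?case
        using zero_free_disc_poly_bounds(2)[OF free degree_poly_const_le[OF bd], of r x] elim x
        by (simp add: poly_poly_const)
    qed
  qed simp
  \<comment> \<open>Otherwise \<open>up\<close> would make the slice vanish on the whole circle,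
    giving infinitely many zeros on the torus.\<close>
  have "peval2 p 0 \<zeta> \<noteq> 0"
  proof
    assume "peval2 p 0 \<zeta> = 0"
    hence "(\<lambda>y. (y, \<zeta>)) ` sphere 0 1 \<subseteq> {(z1, z2). cmod z1 = 1 \<and> cmod z2 = 1 \<and> peval2 p z1 z2 = 0}"
      using up \<zeta> by fastforce
    hence "finite ((\<lambda>y. (y, \<zeta>)) ` sphere (0::complex) 1)"
      using at finite_subset unfolding atoral_def by blast
    hence "finite (sphere (0::complex) 1)"
      by (rule finite_imageD) (auto simp: inj_on_def)
    thus False using infinite_unit_circle by blast
  qed
  hence "(1 - cmod x) ^ m * cmod (peval2 p 0 \<zeta>) > 0" using x by simp
  thus ?thesis using lo by (auto simp: poly_poly_const)
qed

section \<open>The power law for \<open>eps_phi\<close> near a singularity\<close>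

theorem mainTheorem2:
  fixes p :: "complex poly poly" and m n :: nat and \<tau>1 \<tau>2 :: complex
  assumes "has_bidegree p m n"
    and "no_zeros_bidisk p"
    and "atoral m n p"
    and "is_singularity p \<tau>1 \<tau>2"
  shows "\<exists>K::real. K \<in> \<rat> \<and> K > 0 \<and>
          (\<exists>c C :: real. 0 < c \<and> c \<le> C \<and>
            (\<exists>U. openin (top_of_set (sphere (0::complex) 1)) U \<and> \<tau>2 \<in> U \<and>
              (\<forall>\<zeta>2\<in>U. c * cmod (\<tau>2 - \<zeta>2) powr K \<le> eps_phi m n p \<zeta>2
                       \<and> eps_phi m n p \<zeta>2 \<le> C * cmod (\<tau>2 - \<zeta>2) powr K)))"
proof -
  define Q where "Q = (\<lambda>\<zeta>. poly (reflect2 m n p) [:\<zeta>:])"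
  have free: "poly (poly p [:\<zeta>:]) x \<noteq> 0" if "cmod \<zeta> = 1" "cmod x < 1" for \<zeta> x
    by (rule zero_free_disc_circle[OF assms(1-3) that])
  have Q_eval: "poly (Q \<zeta>) z = z ^ m * \<zeta> ^ n * cnj (poly (poly p [:\<zeta>:]) (1 / cnj z))"
    if "cmod \<zeta> = 1" "z \<noteq> 0" for \<zeta> z
    unfolding Q_def by (rule poly_reflect2_circle[OF assms(1) that])
  \<comment> \<open>This coefficient is \<zeta>^n times the conjugate of p(0, \<zeta>), so the
    number of roots, with multiplicity, is exactly \<open>m\<close> all around the circle.\<close>
  have lead: "coeff (Q \<zeta>) m \<noteq> 0" if "cmod \<zeta> = 1" for \<zeta>
    using coeff_reflect2_circle[OF assms(1) that, of 0] free[OF that, of 0] that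
    by (auto simp: Q_def poly_0_coeff_0)
  have deg: "degree (Q \<zeta>) = m" if "cmod \<zeta> = 1" for \<zeta>
    using le_degree[OF lead[OF that]] degree_reflect2_const_le[of m n p \<zeta>] by (simp add: Q_def)
  \<comment> \<open>A root z outside the closed disc would reflect to the zero 1 / cnj z of the
    slice of \<open>p\<close> inside it.\<close>
  have root_le: "cmod z \<le> 1" if "cmod \<zeta> = 1" "poly (Q \<zeta>) z = 0" for \<zeta> z
  proof (rule ccontr)
    assume "\<not> cmod z \<le> 1"
    hence z: "z \<noteq> 0" "cmod (1 / cnj z) < 1" by (auto simp: norm_divide divide_less_eq)
    have "\<zeta> \<noteq> 0" using that by auto
    with Q_eval[OF that(1) z(1)] that(2) free[OF that(1) z(2)] z(1) show False by simp
  qed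
  have root_circle: "poly (Q \<zeta>) z = 0 \<longleftrightarrow> is_singularity p z \<zeta>" if "cmod \<zeta> = 1" "cmod z = 1" for \<zeta> z
  proof -
    have "1 / cnj z = z"
      using that(2) complex_norm_square[of z] by (auto simp: divide_eq_eq)
    moreover have "\<zeta> \<noteq> 0" "z \<noteq> 0" using that by auto
    ultimately show ?thesis
      using that by (simp add: Q_eval is_singularity_def poly_poly_const)
  qed
  \<comment> \<open>The roots are numbered separately for each \<zeta>, with no continuity in
    \<zeta>; the rationality argument uses symmetric functions of them only.\<close>
  have "\<exists>z. cmod \<zeta> = 1 \<longrightarrow> Q \<zeta> = smult (coeff (Q \<zeta>) m) (\<Prod>i<m. [:- z i, 1:])" for \<zeta>
    using complex_poly_factorization[of "Q \<zeta>"] deg lead by fastforce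
  then obtain z where z: "\<And>\<zeta>. cmod \<zeta> = 1 \<Longrightarrow> Q \<zeta> = smult (coeff (Q \<zeta>) m) (\<Prod>i<m. [:- z \<zeta> i, 1:])"
    by metis
  have Q_root: "poly (Q \<zeta>) x = 0 \<longleftrightarrow> (\<exists>i<m. x = z \<zeta> i)" if "cmod \<zeta> = 1" for \<zeta> x
    by (subst z[OF that]) (auto simp: poly_prod lead[OF that])
  have \<tau>: "cmod \<tau>1 = 1" "cmod \<tau>2 = 1" using assms(4) by (auto simp: is_singularity_def)
  hence "poly (Q \<tau>2) \<tau>1 = 0" using root_circle assms(4) by blast
  \<comment> \<open>Besides giving a root of modulus 1 at \<tau>2, this index shows m > 0, so the
    minima and infima below are over nonempty sets.\<close>
  then obtain i0 where i0: "i0 < m" "\<tau>1 = z \<tau>2 i0" using Q_root \<tau> by blast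
  have z_le: "cmod (z \<zeta> i) \<le> 1" if "cmod \<zeta> = 1" "i < m" for \<zeta> i
    using root_le Q_root that by blast

  have rat_coeff: "rational_on_circle (\<lambda>\<zeta>. coeff (Q \<zeta>) (m - k))" if "k \<le> m" for k
    unfolding Q_def coeff_reflect2_const[OF that]
    by (intro rational_on_circle_sum rational_on_circle_mult rational_on_circle_const)
      (use rational_on_circle_poly[of "monom 1 _"] in \<open>simp add: poly_monom\<close>)
  have rat_e: "rational_on_circle (\<lambda>\<zeta>. coeff (\<Prod>i<m. [:1, - z \<zeta> i:]) k)" for k
  proof (cases "k \<le> m")
    case True
    show ?thesis
    proof (rule rational_on_circle_cong)
      show "rational_on_circle (\<lambda>\<zeta>. coeff (Q \<zeta>) (m - k) * inverse (coeff (Q \<zeta>) m))"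
        using rat_coeff[of 0] lead
        by (intro rational_on_circle_mult rational_on_circle_inverse rat_coeff True) auto
      fix \<zeta> :: complex assume \<zeta>: "cmod \<zeta> = 1"
      \<comment> \<open>Reversal turns the factors X - z_i into 1 - z_i X, so the coefficients of
        the normalized product are quotients of coefficients of \<open>Q \<zeta>\<close> by the
        nonvanishing leading one.\<close>
      have "reflect_poly (Q \<zeta>) = smult (coeff (Q \<zeta>) m) (\<Prod>i<m. [:1, - z \<zeta> i:])"
        by (subst z[OF \<zeta>]) (simp add: reflect_poly_smult reflect_poly_prod reflect_poly_linear)
      hence "coeff (Q \<zeta>) (m - k) = coeff (Q \<zeta>) m * coeff (\<Prod>i<m. [:1, - z \<zeta> i:]) k"
        using True coeff_reflect_poly[of "Q \<zeta>" k] by (simp add: deg[OF \<zeta>])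
      thus "coeff (\<Prod>i<m. [:1, - z \<zeta> i:]) k = coeff (Q \<zeta>) (m - k) * inverse (coeff (Q \<zeta>) m)"
        using lead[OF \<zeta>] by simp
    qed
  next
    case False
    hence "coeff (\<Prod>i<m. [:1, - z \<zeta> i:]) k = 0" for \<zeta>
      using degree_prod_one_minus_le[of "z \<zeta>" "{..<m}"] by (intro coeff_eq_0) simp
    thus ?thesis by (simp add: rational_on_circle_const)
  qed
  have rat_S: "rational_on_circle (\<lambda>\<zeta>. \<Sum>i<m. z \<zeta> i ^ k)" for k
    by (rule power_sum_rational_on_circle[OF _ rat_e]) simp

  define I where "I = {..<m} \<times> {..<m}"
  define r where "r = (\<lambda>\<zeta> (i, j). 1 - z \<zeta> i * cnj (z \<zeta> j))"
  define N where "N = card I"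
  define f where "f = (\<lambda>k \<zeta>. coeff (\<Prod>x\<in>I. [:1, - r \<zeta> x:]) k)"
  have I: "finite I" by (simp add: I_def)
  have "N > 0" using i0 by (auto simp: N_def I_def)
  have rat_f: "rational_on_circle (f k)" for k
    unfolding f_def
  proof (rule coeff_prod_rational_on_circle[OF I])
    show "rational_on_circle (\<lambda>\<zeta>. \<Sum>x\<in>I. r \<zeta> x ^ k)" for k
      unfolding I_def r_def power_sum_one_minus_mult_cnj
      by (intro rational_on_circle_sum rational_on_circle_mult rational_on_circle_cnj
          rational_on_circle_const rat_S)
  qed
  have f0: "f 0 \<zeta> = 1" for \<zeta>
    by (simp add: f_def poly_0_coeff_0[symmetric] poly_prod)
  have fN: "f N \<zeta> = (\<Prod>x\<in>I. - r \<zeta> x)" for \<zeta>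
    unfolding f_def N_def by (rule coeff_prod_one_minus_card[OF I])

  \<comment> \<open>The square is used because 1 - |z_i|^2 is exactly the diagonal entry
    \<open>r \<zeta> (i, i)\<close>.\<close>
  define \<rho> where "\<rho> = (\<lambda>\<zeta>. Min ((\<lambda>i. 1 - cmod (z \<zeta> i) ^ 2) ` {..<m}))"
  have \<rho>_le: "\<rho> \<zeta> \<le> 1 - cmod (z \<zeta> i) ^ 2" if "i < m" for \<zeta> i
    unfolding \<rho>_def using that by (intro Min_le) auto
  have \<rho>_att: "\<exists>i<m. \<rho> \<zeta> = 1 - cmod (z \<zeta> i) ^ 2" for \<zeta>
  proof -
    have "\<rho> \<zeta> \<in> (\<lambda>i. 1 - cmod (z \<zeta> i) ^ 2) ` {..<m}"
      unfolding \<rho>_def using i0 by (intro Min_in) auto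
    thus ?thesis by auto
  qed
  have \<rho>_nonneg: "\<rho> \<zeta> \<ge> 0" if "cmod \<zeta> = 1" for \<zeta>
    using \<rho>_att[of \<zeta>] z_le[OF that] by (auto simp: power_le_one)
  have \<rho>_r: "\<rho> \<zeta> \<le> cmod (r \<zeta> x)" if "cmod \<zeta> = 1" "x \<in> I" for \<zeta> x
    using that \<rho>_le \<rho>_nonneg by (auto simp: I_def r_def intro!: le_cmod_one_minus_mult_cnj)
  have \<rho>_pos: "\<rho> \<zeta> > 0 \<longleftrightarrow> (\<nexists>x. is_singularity p x \<zeta>)" if \<zeta>: "cmod \<zeta> = 1" for \<zeta>
  proof
    assume pos: "\<rho> \<zeta> > 0"
    show "\<nexists>x. is_singularity p x \<zeta>"
    proof
      assume "\<exists>x. is_singularity p x \<zeta>"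
      then obtain x where x: "is_singularity p x \<zeta>" ..
      hence "cmod x = 1" by (simp add: is_singularity_def)
      then obtain i where "i < m" "x = z \<zeta> i" using root_circle[OF \<zeta>] Q_root[OF \<zeta>] x by blast
      with \<rho>_le[of i \<zeta>] \<open>cmod x = 1\<close> pos show False by simp
    qed
  next
    assume ns: "\<nexists>x. is_singularity p x \<zeta>"
    obtain i where i: "i < m" "\<rho> \<zeta> = 1 - cmod (z \<zeta> i) ^ 2" using \<rho>_att by blast
    have "cmod (z \<zeta> i) \<noteq> 1" using root_circle[OF \<zeta>] Q_root[OF \<zeta>] ns i by blast
    hence "cmod (z \<zeta> i) < 1" using z_le[OF \<zeta> i(1)] by simp
    thus "\<rho> \<zeta> > 0" unfolding i by (simp add: power_less_one_iff)
  qed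

  have "\<exists>K c C. K \<in> \<rat> \<and> K > 0 \<and> 0 < c \<and> 0 < C \<and>
    (\<forall>\<^sub>F \<zeta> in at \<tau>2 within sphere 0 1.
       c * cmod (\<tau>2 - \<zeta>) powr K \<le> \<rho> \<zeta> \<and> \<rho> \<zeta> \<le> C * cmod (\<tau>2 - \<zeta>) powr K)"
  proof (rule smallest_root_power_law[where f = f and \<rho> = \<rho> and N = N and D = "2 ^ N", OF rat_f \<tau>(2) \<open>N > 0\<close> f0 _ _ \<rho>_nonneg])
    \<comment> \<open>The singularity makes the diagonal factor at (i0, i0) vanish, and with it the
      top coefficient.\<close>
    have "cmod (z \<tau>2 i0) = 1" using i0 \<tau> by simp
    hence "r \<tau>2 (i0, i0) = 0" using complex_norm_square[of "z \<tau>2 i0"] by (simp add: r_def)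
    thus "f N \<tau>2 = 0"
      unfolding fN using i0 I by (intro prod_zero) (auto simp: I_def)
    \<comment> \<open>Finitely many heights carry a singularity, so some height on the circle has
      none. There \<rho> is positive, every \<open>r \<zeta> x\<close> is nonzero, and
      \<open>f N\<close> is not identically zero.\<close>
    define Z where "Z = snd ` {(z1, z2). cmod z1 = 1 \<and> cmod z2 = 1 \<and> peval2 p z1 z2 = 0}"
    have "finite Z"
      using assms(3) by (simp add: atoral_def Z_def)
    hence "\<not> sphere 0 1 \<subseteq> Z"
      using infinite_unit_circle finite_subset[of "sphere 0 1" Z] by blast
    then obtain \<zeta> where \<zeta>: "\<zeta> \<in> sphere 0 1" "\<zeta> \<notin> Z"
      by (meson subsetI)
    have "\<nexists>x. is_singularity p x \<zeta>"
    proof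
      assume "\<exists>x. is_singularity p x \<zeta>"
      then obtain x where "is_singularity p x \<zeta>" ..
      hence "(x, \<zeta>) \<in> {(z1, z2). cmod z1 = 1 \<and> cmod z2 = 1 \<and> peval2 p z1 z2 = 0}"
        by (simp add: is_singularity_def)
      from imageI[OF this, of snd] \<zeta>(2) show False by (simp add: Z_def)
    qed
    hence "\<rho> \<zeta> > 0" using \<rho>_pos \<zeta>(1) by simp
    hence "r \<zeta> x \<noteq> 0" if "x \<in> I" for x using \<rho>_r[OF _ that, of \<zeta>] \<zeta>(1) by auto
    hence "f N \<zeta> \<noteq> 0" unfolding fN using I by simp
    thus "\<exists>\<zeta>. cmod \<zeta> = 1 \<and> f N \<zeta> \<noteq> 0" using \<zeta>(1) by auto
  next
    fix \<zeta> :: complex and j assume "cmod \<zeta> = 1" "j < N"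
    thus "cmod (f j \<zeta>) * \<rho> \<zeta> ^ (N - j) \<le> 2 ^ N * cmod (f N \<zeta>)"
      unfolding f_def N_def
      by (intro coeff_prod_one_minus_le I \<rho>_nonneg \<rho>_r) auto
  next
    fix \<zeta> :: complex assume \<zeta>: "cmod \<zeta> = 1"
    obtain i where i: "i < m" "\<rho> \<zeta> = 1 - cmod (z \<zeta> i) ^ 2" using \<rho>_att by blast
    have "r \<zeta> (i, i) = of_real (\<rho> \<zeta>)"
      using complex_norm_square[of "z \<zeta> i"] i by (simp add: r_def)
    hence "cmod (r \<zeta> (i, i)) = \<rho> \<zeta>" using \<rho>_nonneg[OF \<zeta>] by simp
    thus "cmod (f N \<zeta>) \<le> (\<Sum>j<N. cmod (f j \<zeta>) * \<rho> \<zeta> ^ (N - j))"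
      using coeff_prod_one_minus_ge[OF I, of "(i, i)" "r \<zeta>"] i by (simp add: f_def N_def I_def)
  qed
  then obtain K c C where K: "K \<in> \<rat>" "K > 0" "0 < c" "0 < C"
    "\<forall>\<^sub>F \<zeta> in at \<tau>2 within sphere 0 1.
       c * cmod (\<tau>2 - \<zeta>) powr K \<le> \<rho> \<zeta> \<and> \<rho> \<zeta> \<le> C * cmod (\<tau>2 - \<zeta>) powr K"
    by blast
  then obtain S where S: "open S" "\<tau>2 \<in> S"
    "\<And>\<zeta>. \<zeta> \<in> S \<Longrightarrow> \<zeta> \<noteq> \<tau>2 \<Longrightarrow> cmod \<zeta> = 1 \<Longrightarrow>
       c * cmod (\<tau>2 - \<zeta>) powr K \<le> \<rho> \<zeta> \<and> \<rho> \<zeta> \<le> C * cmod (\<tau>2 - \<zeta>) powr K"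
    unfolding eventually_at_topological by auto
  \<comment> \<open>For |z| <= 1 one has 1 - |z| <= 1 - |z|^2 <= 2 (1 - |z|), whence the factor 1/2
    in the lower constant. The maximum only secures that the lower constant does not exceed the
    upper one.\<close>
  have main: "c / 2 * cmod (\<tau>2 - \<zeta>) powr K \<le> eps_phi m n p \<zeta>
      \<and> eps_phi m n p \<zeta> \<le> max C (c / 2) * cmod (\<tau>2 - \<zeta>) powr K" if "\<zeta> \<in> sphere 0 1 \<inter> S" for \<zeta>
  proof (cases "\<zeta> = \<tau>2")
    case True
    \<comment> \<open>At \<tau>2 itself all three quantities are 0: \<open>eps_phi\<close> by its
      default value and the bounds because \<open>0 powr K = 0\<close>.\<close>
    have "eps_phi m n p \<tau>2 = 0" using assms(4) by (auto simp: eps_phi_def)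
    thus ?thesis using True by simp
  next
    case False
    have \<zeta>: "cmod \<zeta> = 1" using that by simp
    let ?s = "cmod (\<tau>2 - \<zeta>) powr K"
    let ?X = "{1 - cmod x | x. peval2 (reflect2 m n p) x \<zeta> = 0}"
    have \<rho>: "c * ?s \<le> \<rho> \<zeta>" "\<rho> \<zeta> \<le> C * ?s" using S(3)[of \<zeta>] that False by auto
    have "0 < c * ?s" using K False by simp
    \<comment> \<open>Positivity excludes a singularity at height \<zeta>, so \<open>eps_phi\<close>
      is the infimum there.\<close>
    hence "\<rho> \<zeta> > 0" using \<rho>(1) by linarith
    hence eps: "eps_phi m n p \<zeta> = Inf ?X" using \<rho>_pos[OF \<zeta>] by (simp add: eps_phi_def)
    have X: "?X = (\<lambda>i. 1 - cmod (z \<zeta> i)) ` {..<m}"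
      using Q_root[OF \<zeta>] by (auto simp: poly_poly_const[symmetric] Q_def)
    have "c / 2 * ?s \<le> Inf ?X"
      unfolding X
    proof (rule cInf_greatest)
      fix y assume "y \<in> (\<lambda>i. 1 - cmod (z \<zeta> i)) ` {..<m}"
      then obtain i where i: "i < m" "y = 1 - cmod (z \<zeta> i)" by auto
      have "1 - cmod (z \<zeta> i) ^ 2 = (1 + cmod (z \<zeta> i)) * y"
        unfolding i by (simp add: power2_eq_square algebra_simps)
      also have "\<dots> \<le> 2 * y"
        by (rule mult_right_mono) (use z_le[OF \<zeta> i(1)] i in auto)
      finally show "c / 2 * ?s \<le> y" using \<rho>(1) \<rho>_le[OF i(1), of \<zeta>] by simp
    qed (use i0 in auto)
    moreover have "Inf ?X \<le> max C (c / 2) * ?s"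
    proof -
      obtain i where i: "i < m" "\<rho> \<zeta> = 1 - cmod (z \<zeta> i) ^ 2" using \<rho>_att by blast
      have "Inf ?X \<le> 1 - cmod (z \<zeta> i)"
        unfolding X using i by (intro cInf_lower) auto
      also have "\<dots> \<le> \<rho> \<zeta>"
        unfolding i using z_le[OF \<zeta> i(1)] power_decreasing[of 1 2 "cmod (z \<zeta> i)"] by simp
      also have "\<dots> \<le> C * ?s" by (rule \<rho>)
      also have "\<dots> \<le> max C (c / 2) * ?s" by (rule mult_right_mono) auto
      finally show ?thesis .
    qed
    ultimately show ?thesis unfolding eps by simp
  qed
  have "openin (top_of_set (sphere 0 1)) (sphere 0 1 \<inter> S)"
    using S(1) by (simp add: openin_open_Int)
  moreover have "\<tau>2 \<in> sphere 0 1 \<inter> S" using S(2) \<tau> by simp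
  ultimately show ?thesis
    using main K(1-4)
    by (intro exI[of _ K] conjI exI[of _ "c / 2"] exI[of _ "max C (c / 2)"] exI[of _ "sphere 0 1 \<inter> S"]) auto
qed

end
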